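(* Let $n\ge1$, let $r$ be an odd prime, and let $a=(a_1,\dots,a_r)$ be a sequence of nonnegative integers with $\sum_k a_k=n$ such that the multinomial coefficients $\binom{n-1}{a_1,\dots,a_k-1,\dots,a_r}$, $1\le k\le r$, all lie in the same residue class modulo $r$. Then for every $r$-tuple $\lambda=(\lambda_1,\dots,\lambda_r)$ of partitions with $|\lambda_k|=a_k$ for all $k$, one has $x_\lambda\equiv0\pmod r$.
   Context: A multinomial coefficient with a negative lower entry is $0$. For a partition $\mu$ of $m$, $f_\mu$ is the dimension of the irreducible complex representation of $S_m$ indexed by $\mu$. For $\lambda=(\lambda_1,\dots,\lambda_r)$ with $|\lambda_k|=a_k$, $$x_\lambda=f_{\lambda_1}\cdots f_{\lambda_r}\sum_{k=1}^{r-1}k\binom{n-1}{a_1,\dots,a_{k+1}-1,\dots,a_r}.$$ *)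

theory Defs
  imports Complex_Main "HOL-Library.Function_Algebras" "HOL-Combinatorics.Permutations" "HOL-Number_Theory.Cong"
begin

definition is_partition :: "nat \<Rightarrow> nat list \<Rightarrow> bool" where
  "is_partition m \<mu> \<longleftrightarrow> sorted_wrt (\<ge>) \<mu> \<and> 0 \<notin> set \<mu> \<and> sum_list \<mu> = m"


text \<open>
  The irreducible complex representation of the symmetric group indexed by a partition \<open>\<mu>\<close>
  of \<open>m\<close> is realised as the Specht module, i.e. the left ideal of the group algebra generated
  by the Young symmetrizer of the tableau of shape \<open>\<mu>\<close> with entries \<open>0, \<dots>, m - 1\<close> in row
  reading order.  The group is the set of permutations of \<open>{..<m}\<close>; an element of the group
  algebra is the function giving its coefficients (zero outside the group).  In this convention
  the one-row partition indexes the trivial representation.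
\<close>

type_synonym galg = "(nat \<Rightarrow> nat) \<Rightarrow> complex"

definition galg_scale :: "complex \<Rightarrow> galg \<Rightarrow> galg" where
  "galg_scale c v = (\<lambda>\<pi>. c * v \<pi>)"

interpretation galg: vector_space galg_scale
  by unfold_locales (auto simp: galg_scale_def fun_eq_iff algebra_simps)

text \<open>Left multiplication by \<open>\<sigma>\<close>: it sends the basis element \<open>\<pi>\<close> to \<open>\<sigma> \<circ> \<pi>\<close>.\<close>

definition galg_act :: "(nat \<Rightarrow> nat) \<Rightarrow> galg \<Rightarrow> galg" where
  "galg_act \<sigma> v = (\<lambda>\<pi>. v (inv \<sigma> \<circ> \<pi>))"

definition cell_row :: "nat list \<Rightarrow> nat \<Rightarrow> nat" where
  "cell_row \<mu> i = (LEAST j. i < sum_list (take (Suc j) \<mu>))"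

definition cell_col :: "nat list \<Rightarrow> nat \<Rightarrow> nat" where
  "cell_col \<mu> i = i - sum_list (take (cell_row \<mu> i) \<mu>)"

definition row_stabilizer :: "nat list \<Rightarrow> (nat \<Rightarrow> nat) set" where
  "row_stabilizer \<mu> =
     {p. p permutes {..<sum_list \<mu>} \<and> (\<forall>i<sum_list \<mu>. cell_row \<mu> (p i) = cell_row \<mu> i)}"

definition col_stabilizer :: "nat list \<Rightarrow> (nat \<Rightarrow> nat) set" where
  "col_stabilizer \<mu> =
     {q. q permutes {..<sum_list \<mu>} \<and> (\<forall>i<sum_list \<mu>. cell_col \<mu> (q i) = cell_col \<mu> i)}"

definition young_symmetrizer :: "nat list \<Rightarrow> galg" where
  "young_symmetrizer \<mu> =
     (\<lambda>\<pi>. \<Sum>p\<in>row_stabilizer \<mu>. \<Sum>q\<in>col_stabilizer \<mu>. if \<pi> = p \<circ> q then of_int (sign q) else 0)"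

definition specht_module :: "nat list \<Rightarrow> galg set" where
  "specht_module \<mu> =
     galg.span {galg_act \<sigma> (young_symmetrizer \<mu>) | \<sigma>. \<sigma> permutes {..<sum_list \<mu>}}"

lemma specht_module_invariant:
  assumes "\<tau> permutes {..<sum_list \<mu>}" "v \<in> specht_module \<mu>"
  shows "galg_act \<tau> v \<in> specht_module \<mu>"
  using assms(2) unfolding specht_module_def
proof (induction rule: galg.span_induct_alt)
  case base
  have "galg_act \<tau> 0 = 0" by (simp add: galg_act_def fun_eq_iff)
  then show ?case by (simp only: galg.span_zero)
next
  case (step c x y)
  then obtain \<sigma> where \<sigma>: "\<sigma> permutes {..<sum_list \<mu>}"
    and x: "x = galg_act \<sigma> (young_symmetrizer \<mu>)" by blast
  have "galg_act \<tau> x = galg_act (\<tau> \<circ> \<sigma>) (young_symmetrizer \<mu>)"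
    using \<sigma> assms(1)
    by (simp add: x galg_act_def fun_eq_iff o_inv_distrib permutes_bij comp_assoc)
  moreover have "\<tau> \<circ> \<sigma> permutes {..<sum_list \<mu>}"
    using \<sigma> assms(1) by (rule permutes_compose)
  ultimately have "galg_act \<tau> x \<in> galg.span
      {galg_act \<sigma> (young_symmetrizer \<mu>) | \<sigma>. \<sigma> permutes {..<sum_list \<mu>}}"
    by (auto intro: galg.span_base)
  moreover have "galg_act \<tau> (galg_scale c x + y) = galg_scale c (galg_act \<tau> x) + galg_act \<tau> y"
    by (simp add: galg_act_def galg_scale_def fun_eq_iff)
  ultimately show ?case
    using step(2) by (simp only: galg.span_add galg.span_scale)
qed

definition irrep_dim :: "nat list \<Rightarrow> nat" where
  "irrep_dim \<mu> = galg.dim (specht_module \<mu>)"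


text \<open>
  The multinomial coefficient with upper entry \<open>m\<close> and lower entries \<open>b 1, \<dots>, b r\<close>, for
  \<open>b 1 + \<dots> + b r = m\<close>.  The lower entries are integers, since they may be negative.
\<close>

definition multinomial :: "nat \<Rightarrow> nat \<Rightarrow> (nat \<Rightarrow> int) \<Rightarrow> nat" where
  "multinomial m r b =
     (if \<exists>k\<in>{1..r}. b k < 0 then 0 else fact m div (\<Prod>k=1..r. fact (nat (b k))))"

text \<open>
  The multinomial coefficient with upper entry \<open>n - 1\<close> and lower entries
  \<open>a 1, \<dots>, a k - 1, \<dots>, a r\<close>.
\<close>

definition multinomial_dec :: "nat \<Rightarrow> nat \<Rightarrow> (nat \<Rightarrow> nat) \<Rightarrow> nat \<Rightarrow> nat" where
  "multinomial_dec n r a k =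
     multinomial (n - 1) r ((\<lambda>j. int (a j))(k := int (a k) - 1))"

text \<open>\<open>x\<^sub>\<lambda>\<close> for the tuple \<open>\<lambda> 1, \<dots>, \<lambda> r\<close>; here \<open>a k = |\<lambda> k|\<close> and \<open>n\<close> is their sum.\<close>

definition x_coeff :: "nat \<Rightarrow> (nat \<Rightarrow> nat list) \<Rightarrow> nat" where
  "x_coeff r lam =
     (let a = (\<lambda>k. sum_list (lam k)); n = (\<Sum>k=1..r. a k)
      in (\<Prod>k=1..r. irrep_dim (lam k)) * (\<Sum>k=1..r-1. k * multinomial_dec n r a (k + 1)))"

end

theory Submission
  imports Defs
begin

text \<open>Modulo \<open>r\<close> the multinomial coefficients share one residue c, so the
  weighted sum in \<open>x_coeff\<close> is congruent to c * (1 + ... + (r-1)) = c * r(r-1)/2. For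
  odd \<open>r\<close> this is a multiple of \<open>r\<close> (\<open>odd_dvd_sum_below\<close>),
  and multiplying by the dimensions preserves divisibility.\<close>

lemma multinomial_dec_cong:
  assumes "\<And>j. j \<in> {1..r} \<Longrightarrow> a j = b j" and "k \<in> {1..r}"
  shows "multinomial_dec n r a k = multinomial_dec n r b k"
proof -
  have eq: "((\<lambda>j. int (a j))(k := int (a k) - 1)) j = ((\<lambda>j. int (b j))(k := int (b k) - 1)) j"
    if "j \<in> {1..r}" for j
    using assms that by simp
  then show ?thesis
    unfolding multinomial_dec_def multinomial_def
    by (simp only: eq cong: bex_cong prod.cong)
qed

text \<open>The sum is r(r-1)/2, and (r-1)/2 is an integer because \<open>r\<close> is odd; for
  \<open>r = 2\<close> the sum is 1 and the claim fails.\<close>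

lemma odd_dvd_sum_below:
  fixes r :: nat
  assumes "odd r"
  shows "r dvd (\<Sum>k=1..r-1. k)"
proof -
  obtain m where m: "r = Suc (2 * m)"
    using assms by (auto elim: oddE)
  have "(\<Sum>k=1..r-1. k) = r * m"
    using gauss_sum_from_Suc_0 [where 'a = nat, of "r - 1"] by (simp add: m)
  then show ?thesis
    by simp
qed

theorem theorem5:
  fixes n r :: nat and a :: "nat \<Rightarrow> nat" and lam :: "nat \<Rightarrow> nat list"
  assumes "n \<ge> 1"
    and "prime r" and "odd r"
    and "(\<Sum>k=1..r. a k) = n"
    and "\<forall>j\<in>{1..r}. \<forall>k\<in>{1..r}. [multinomial_dec n r a j = multinomial_dec n r a k] (mod r)"
    and "\<forall>k\<in>{1..r}. is_partition (a k) (lam k)"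
  shows "[x_coeff r lam = 0] (mod r)"
proof -
  define S where "S = (\<Sum>k=1..r-1. k * multinomial_dec n r a (k + 1))"
  have size: "sum_list (lam k) = a k" if "k \<in> {1..r}" for k
    using assms(6) that by (simp add: is_partition_def)
  have n: "(\<Sum>k=1..r. sum_list (lam k)) = n"
    using size assms(4) by simp
  \<comment> \<open>\<open>x_coeff\<close> reads the sizes off \<open>lam\<close>; these agree with
    \<open>a\<close> only on \<open>{1..r}\<close>, so the two functions cannot simply be rewritten
    into each other.\<close>
  have "(\<Sum>k=1..r-1. k * multinomial_dec n r (\<lambda>k. sum_list (lam k)) (k + 1)) = S"
    unfolding S_def
  proof (rule sum.cong [OF refl])
    fix k assume "k \<in> {1..r-1}"
    then have "k + 1 \<in> {1..r}" by auto
    then show "k * multinomial_dec n r (\<lambda>k. sum_list (lam k)) (k + 1) =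
        k * multinomial_dec n r a (k + 1)"
      using multinomial_dec_cong [of r "\<lambda>k. sum_list (lam k)" a] size by simp
  qed
  then have x: "x_coeff r lam = (\<Prod>k=1..r. irrep_dim (lam k)) * S"
    unfolding x_coeff_def Let_def n by simp
  \<comment> \<open>The coefficient at index 1 represents the common residue; it is constant in
    \<open>k\<close> and so factors out of the sum.\<close>
  have "[S = (\<Sum>k=1..r-1. k * multinomial_dec n r a 1)] (mod r)"
    unfolding S_def
  proof (intro cong_sum cong_mult cong_refl)
    fix k assume "k \<in> {1..r-1}"
    then have "k + 1 \<in> {1..r}" "1 \<in> {1..r}" by auto
    then show "[multinomial_dec n r a (k + 1) = multinomial_dec n r a 1] (mod r)"
      using assms(5) by blast
  qed
  moreover have "r dvd (\<Sum>k=1..r-1. k * multinomial_dec n r a 1)"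
    unfolding sum_distrib_right [symmetric] using odd_dvd_sum_below [OF \<open>odd r\<close>] by (rule dvd_mult2)
  ultimately have "r dvd S"
    using cong_dvd_iff by blast
  then show ?thesis
    by (simp add: x cong_0_iff)
qed

end
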